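(* Let $s\geq 2$ and $n\geq 3s-2$ be integers, and let $G$ be a graph of order $n$ with complement $\overline{G}$. Then \[ \mu_s^2(G)+\mu_s^2(\overline{G})<\frac{n^2}{4(s-1)}. \]
   Context: Graphs are finite and simple. For a graph $G$ of order $n$, $\mu_1(G)\geq\mu_2(G)\geq\cdots\geq\mu_n(G)$ denote the eigenvalues of its adjacency matrix, and $\overline{G}$ denotes the complement of $G$. *)

theory Defs
  imports
    "Graph_Theory.Pair_Digraph"
    "Jordan_Normal_Form.Char_Poly"
    "HOL-Library.Multiset"
begin

text \<open>
  A finite simple graph is a record satisfying \<open>pair_graph\<close>: its vertex set is finite and its arc
  set is a finite, symmetric, irreflexive relation on the vertices, each edge being represented by
  its two orientations.
\<close>

definition graph_complement :: "'a pair_pre_digraph \<Rightarrow> 'a pair_pre_digraph" where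
  "graph_complement G =
     \<lparr> pverts = pverts G,
       parcs = {(u, v). u \<in> pverts G \<and> v \<in> pverts G \<and> u \<noteq> v \<and> (u, v) \<notin> parcs G} \<rparr>"

definition adjacency_matrix :: "'a pair_pre_digraph \<Rightarrow> 'a list \<Rightarrow> real mat" where
  "adjacency_matrix G vs =
     mat (length vs) (length vs) (\<lambda>(i, j). if (vs ! i, vs ! j) \<in> parcs G then 1 else 0)"

text \<open>
  All eigenvalues with algebraic multiplicity, in non-increasing order. The choice of the
  enumeration of the vertices is immaterial (\<open>graph_eigenvalues_eq\<close>), and because the matrix is
  symmetric no eigenvalue is lost by working over the reals (\<open>length_graph_eigenvalues\<close>).
\<close>

definition graph_eigenvalues :: "'a pair_pre_digraph \<Rightarrow> real list" where
  "graph_eigenvalues G =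
     (let vs = (SOME vs. distinct vs \<and> set vs = pverts G)
      in rev (sorted_list_of_multiset (proots (char_poly (adjacency_matrix G vs)))))"

text \<open>Eigenvalues are counted from 1, so \<open>graph_eigenvalue 1 G\<close> is the largest one.\<close>

definition graph_eigenvalue :: "nat \<Rightarrow> 'a pair_pre_digraph \<Rightarrow> real" where
  "graph_eigenvalue k G = graph_eigenvalues G ! (k - 1)"

lemma pair_graph_complement:
  assumes "pair_graph G"
  shows "pair_graph (graph_complement G)"
proof -
  interpret pair_graph G by fact
  have "parcs (graph_complement G) \<subseteq> pverts G \<times> pverts G"
    by (auto simp: graph_complement_def)
  hence "finite (parcs (graph_complement G))"
    using pair_finite_verts finite_subset by blast
  moreover have "(v, u) \<in> parcs G" if "(u, v) \<in> parcs G" for u v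
    using pair_sym_arcs that by (auto simp: symmetric_def sym_def)
  ultimately show ?thesis
    by unfold_locales
      (auto simp: graph_complement_def symmetric_def sym_def pair_finite_verts)
qed

lemma adjacency_matrix_carrier: "adjacency_matrix G vs \<in> carrier_mat (length vs) (length vs)"
  by (simp add: adjacency_matrix_def)

lemma det_permute_rows_cols:
  fixes A :: "'a :: comm_ring_1 mat"
  assumes A: "A \<in> carrier_mat n n" and p: "p permutes {0..<n}"
  shows "det (mat n n (\<lambda>(i, j). A $$ (p i, p j))) = det A"
proof -
  define B where "B = mat n n (\<lambda>(i, j). A $$ (p i, j))"
  have B: "B \<in> carrier_mat n n" by (simp add: B_def)
  have pl: "p i < n" if "i < n" for i
    using permutes_in_image[OF p, of i] that by simp
  have "mat n n (\<lambda>(i, j). A $$ (p i, p j)) =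
      transpose_mat (mat n n (\<lambda>(i, j). transpose_mat B $$ (p i, j)))"
    by (rule eq_matI) (auto simp: B_def pl)
  also have "det \<dots> = det (mat n n (\<lambda>(i, j). transpose_mat B $$ (p i, j)))"
    by (rule det_transpose[of _ n]) simp
  also have "\<dots> = signof p * det (transpose_mat B)"
    by (rule det_permute_rows) (use B p in auto)
  also have "\<dots> = signof p * (signof p * det A)"
    using det_transpose[OF B] det_permute_rows[OF A p] by (simp add: B_def)
  also have "\<dots> = det A"
    by (simp add: sign_def)
  finally show ?thesis .
qed

lemma char_poly_adjacency_matrix_cong:
  assumes "distinct vs" "distinct ws" "set vs = set ws"
  shows "char_poly (adjacency_matrix G vs) = char_poly (adjacency_matrix G ws)"
proof -
  define n where "n = length ws"
  have "mset vs = mset ws"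
    using assms set_eq_iff_mset_eq_distinct by blast
  then obtain p where p: "p permutes {..<length ws}" "permute_list p ws = vs"
    by (rule mset_eq_permutation)
  have len: "length vs = n" using p(2) by (auto simp: n_def)
  have p': "p permutes {0..<n}" using p(1) by (simp add: n_def lessThan_atLeast0)
  have pl: "p i < n" if "i < n" for i
    using permutes_in_image[OF p', of i] that by simp
  have nth: "vs ! i = ws ! p i" if "i < n" for i
    using p that by (auto simp: n_def permute_list_nth)
  have inj: "p i = p j \<longleftrightarrow> i = j" for i j
    using permutes_inj[OF p'] by (auto dest: injD)
  have "char_poly_matrix (adjacency_matrix G vs) =
      mat n n (\<lambda>(i, j). char_poly_matrix (adjacency_matrix G ws) $$ (p i, p j))"
    by (rule eq_matI)
      (auto simp: char_poly_matrix_def adjacency_matrix_def len nth pl inj n_def[symmetric])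
  moreover have "char_poly_matrix (adjacency_matrix G ws) \<in> carrier_mat n n"
    using adjacency_matrix_carrier[of G ws] by (simp add: n_def)
  ultimately show ?thesis
    using det_permute_rows_cols[OF _ p'] by (simp add: char_poly_def)
qed

lemma graph_eigenvalues_eq:
  assumes "distinct vs" "set vs = pverts G"
  shows "graph_eigenvalues G =
    rev (sorted_list_of_multiset (proots (char_poly (adjacency_matrix G vs))))"
proof -
  define ws where "ws = (SOME vs. distinct vs \<and> set vs = pverts G)"
  have "distinct ws \<and> set ws = pverts G"
    unfolding ws_def by (rule someI[of _ vs]) (use assms in simp)
  with assms have "char_poly (adjacency_matrix G ws) = char_poly (adjacency_matrix G vs)"
    by (intro char_poly_adjacency_matrix_cong) auto
  thus ?thesis by (simp add: graph_eigenvalues_def ws_def Let_def)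
qed

lemma eigenvalue_symmetric_real:
  fixes A :: "real mat"
  assumes A: "A \<in> carrier_mat n n" and sym: "transpose_mat A = A"
    and ev: "eigenvalue (map_mat complex_of_real A) k"
  shows "k \<in> \<real>"
proof -
  let ?A = "map_mat complex_of_real A"
  from ev A obtain v where v: "v \<in> carrier_vec n" "v \<noteq> 0\<^sub>v n" "?A *\<^sub>v v = k \<cdot>\<^sub>v v"
    by (auto simp: eigenvalue_def eigenvector_def)
  have cA: "?A \<in> carrier_mat n n" using A by simp
  have symc: "transpose_mat ?A = ?A" using sym by (metis map_mat_transpose)
  define w where "w = conjugate v"
  have w: "w \<in> carrier_vec n" using v by (simp add: w_def)
  have "?A *\<^sub>v w = conjugate (?A *\<^sub>v v)"
    by (rule eq_vecI)
      (use A v(1) in \<open>auto simp: w_def scalar_prod_def cnj_sum\<close>)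
  hence Aw: "?A *\<^sub>v w = cnj k \<cdot>\<^sub>v w"
    using v by (simp add: w_def conjugate_smult_vec)
  have "k * (w \<bullet> v) = w \<bullet> (?A *\<^sub>v v)" using v w by simp
  also have "\<dots> = (transpose_mat ?A *\<^sub>v w) \<bullet> v"
    using transpose_vec_mult_scalar[OF cA v(1) w] by simp
  also have "\<dots> = cnj k * (w \<bullet> v)" using v w by (simp add: symc Aw)
  finally have eq: "k * (w \<bullet> v) = cnj k * (w \<bullet> v)" .
  have "w \<bullet> v = v \<bullet>c v" using comm_scalar_prod[OF w v(1)] by (simp add: w_def)
  hence "w \<bullet> v \<noteq> 0" using v conjugate_square_eq_0_vec by auto
  with eq have "k = cnj k" by simp
  thus ?thesis by (metis Reals_cnj_iff)
qed

lemma size_proots_char_poly_symmetric: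
  fixes A :: "real mat"
  assumes A: "A \<in> carrier_mat n n" and sym: "transpose_mat A = A"
  shows "size (proots (char_poly A)) = n"
proof -
  let ?A = "map_mat complex_of_real A"
  have cA: "?A \<in> carrier_mat n n" using A by simp
  obtain as where as: "char_poly ?A = (\<Prod>a\<leftarrow>as. [:- a, 1:])" "length as = n"
    using char_poly_factorized[OF cA] by blast
  have "a \<in> \<real>" if "a \<in> set as" for a
  proof -
    have "poly (char_poly ?A) a = 0"
      using that by (auto simp: as(1) poly_prod_list prod_list_zero_iff)
    thus ?thesis
      using eigenvalue_symmetric_real[OF A sym] eigenvalue_root_char_poly[OF cA] by blast
  qed
  hence as': "as = map complex_of_real (map Re as)"
    by (auto intro!: map_idI[symmetric])
  define bs where "bs = map Re as"
  have "map_poly complex_of_real (char_poly A) = (\<Prod>a\<leftarrow>as. [:- a, 1:])"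
    using as(1) of_real_hom.char_poly_hom[OF A, where ?'a = complex] by metis
  also have "\<dots> = map_poly complex_of_real (\<Prod>b\<leftarrow>bs. [:- b, 1:])"
  proof -
    interpret h: map_poly_comm_ring_hom complex_of_real ..
    have "map_poly complex_of_real (\<Prod>b\<leftarrow>xs. [:- b, 1:]) =
        (\<Prod>a\<leftarrow>map complex_of_real xs. [:- a, 1:])" for xs
      by (induction xs) (simp_all add: h.hom_mult hom_distribs del: mult_pCons_left)
    thus ?thesis using as' unfolding bs_def by metis
  qed
  finally have "char_poly A = (\<Prod>b\<leftarrow>bs. [:- b, 1:])"
    by (auto simp: poly_eq_iff coeff_map_poly)
  moreover have "proots (\<Prod>b\<leftarrow>bs. [:- b, 1:]) = mset bs" for bs :: "real list"
  proof (induction bs)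
    case (Cons b bs)
    have "(\<Prod>b\<leftarrow>bs. [:- b, 1:]) \<noteq> 0" by (auto simp: prod_list_zero_iff)
    thus ?case using Cons proots_mult[of "[:- b, 1:]" "\<Prod>b\<leftarrow>bs. [:- b, 1:]"] by simp
  qed simp
  moreover have "size (mset bs) = n" using as(2) by (simp add: bs_def)
  ultimately show ?thesis by metis
qed

lemma length_graph_eigenvalues:
  assumes "pair_graph G"
  shows "length (graph_eigenvalues G) = card (pverts G)"
proof -
  interpret pair_graph G by fact
  obtain vs where vs: "set vs = pverts G" "distinct vs"
    using finite_distinct_list[OF pair_finite_verts] by blast
  have "(v, u) \<in> parcs G \<longleftrightarrow> (u, v) \<in> parcs G" for u v
    using pair_sym_arcs by (auto simp: symmetric_def sym_def)
  hence "transpose_mat (adjacency_matrix G vs) = adjacency_matrix G vs"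
    by (intro eq_matI) (auto simp: adjacency_matrix_def)
  hence "size (proots (char_poly (adjacency_matrix G vs))) = length vs"
    by (rule size_proots_char_poly_symmetric[OF adjacency_matrix_carrier])
  thus ?thesis
    using vs distinct_card[OF vs(2)]
    by (simp add: graph_eigenvalues_eq[OF vs(2,1)] flip: size_mset)
qed

end

theory Submission
  imports Defs "Jordan_Normal_Form.Schur_Decomposition"
begin

text \<open>
  Put \<open>m = s - 1\<close> and let \<open>\<alpha>\<^sub>0 \<ge> \<dots> \<ge> \<alpha>\<^bsub>n-1\<^esub>\<close> and \<open>\<beta>\<^sub>0 \<ge> \<dots> \<ge> \<beta>\<^bsub>n-1\<^esub>\<close> be the spectra
  of the two graphs, whose adjacency matrices add up to \<open>J - I\<close>. The squares of all these numbers
  sum to \<open>n (n - 1)\<close>, both spectra sum to \<open>0\<close>, and Weyl's inequalities give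
  \<open>\<alpha>\<^sub>i + \<beta>\<^sub>j \<le> -1\<close> for \<open>i + j = n\<close> and \<open>\<alpha>\<^sub>i + \<beta>\<^sub>j \<ge> -1\<close> for \<open>i + j < n\<close>.
  If \<open>a = \<alpha>\<^sub>m\<close> and \<open>b = \<beta>\<^sub>m\<close> are nonnegative, the last \<open>m\<close> eigenvalues of each graph are at most
  \<open>-(1 + b)\<close> and \<open>-(1 + a)\<close>, so that together with the indices \<open>1, \<dots>, m\<close> they contribute more than
  \<open>2 m (a\<^sup>2 + b\<^sup>2)\<close> to the sum of squares, while
  \<open>\<alpha>\<^sub>0\<^sup>2 + \<beta>\<^sub>0\<^sup>2 \<ge> (n - 1)\<^sup>2 / 2\<close> because \<open>\<alpha>\<^sub>0 + \<beta>\<^sub>0 \<ge> n - 1\<close>. If \<open>a\<close> or \<open>b\<close> is negative, the many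
  eigenvalues below it force, the trace being \<open>0\<close>, the first \<open>m\<close> eigenvalues to be large on average;
  this is where \<open>n \<ge> 3 m + 1\<close> is needed.
\<close>

section \<open>Spectral theorem for real symmetric matrices\<close>

text \<open>Gram-Schmidt, applied to a basis starting with \<open>v\<close>, keeps \<open>v\<close>
  as its first vector. Dividing by the norms then makes the first column a multiple of
  \<open>v\<close>, with \<open>c\<close> the inverse norm.\<close>

lemma orthonormal_basis_completion:
  fixes v :: "real vec"
  assumes v: "v \<in> carrier_vec n" and v0: "v \<noteq> 0\<^sub>v n"
  obtains W c where "W \<in> carrier_mat n n" "W\<^sup>T * W = 1\<^sub>m n" "c \<noteq> 0" "col W 0 = c \<cdot>\<^sub>v v"
proof -
  interpret cof_vec_space n "TYPE(real)" .
  have n0: "n > 0" using v v0 by (cases n) auto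
  define b where "b = basis_completion v"
  note bc = basis_completion[OF v v0, folded b_def]
  define ws where "ws = gram_schmidt n b"
  note gs = gram_schmidt_result[OF bc(2,4,5) ws_def]
  have len: "length ws = n" using gs(4) bc(6) by simp
  have hd: "ws ! 0 = v"
  proof -
    obtain bs where bs: "b = v # bs" using bc(6,7) n0 by (cases b) auto
    have "hd ws = v" using gram_schmidt_hd[OF v] by (simp add: ws_def bs)
    thus ?thesis using n0 len by (metis hd_conv_nth length_greater_0_conv)
  qed
  have wc: "ws ! i \<in> carrier_vec n" if "i < n" for i using gs(3) len that by auto
  have wd: "dim_vec (ws ! i) = n" if "i < n" for i using wc[OF that] by simp
  have conj: "conjugate u = u" for u :: "real vec" by (intro eq_vecI) auto
  define N where "N = (\<lambda>i. sqrt (ws ! i \<bullet> ws ! i))"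
  have orth: "ws ! i \<bullet> ws ! j = 0 \<longleftrightarrow> i \<noteq> j" if "i < n" "j < n" for i j
    using corthogonalD[OF gs(2), of i j] that len by (simp add: conj)
  have nonneg: "u \<bullet> u \<ge> 0" for u :: "real vec" by (auto simp: scalar_prod_def intro!: sum_nonneg)
  have N: "N i * N i = ws ! i \<bullet> ws ! i" for i
    by (simp add: N_def nonneg)
  have N0: "N i \<noteq> 0" if "i < n" for i using orth[OF that that] by (auto simp: N_def)
  define W where "W = mat n n (\<lambda>(i, j). ws ! j $ i / N j)"
  have W: "W \<in> carrier_mat n n" by (simp add: W_def)
  have "W\<^sup>T * W = 1\<^sub>m n"
  proof (rule eq_matI)
    fix i j assume ij: "i < dim_row (1\<^sub>m n :: real mat)" "j < dim_col (1\<^sub>m n :: real mat)"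
    hence "(W\<^sup>T * W) $$ (i, j) = (\<Sum>k = 0..<n. ws ! i $ k / N i * (ws ! j $ k / N j))"
      by (simp add: W_def scalar_prod_def)
    also have "\<dots> = (\<Sum>k = 0..<n. ws ! i $ k * ws ! j $ k) / (N i * N j)"
      by (simp add: sum_divide_distrib)
    also have "\<dots> = (ws ! i \<bullet> ws ! j) / (N i * N j)"
      using ij wd by (simp add: scalar_prod_def)
    also have "\<dots> = 1\<^sub>m n $$ (i, j)"
      using ij orth[of i j] N[of i] N0[of i] by (cases "i = j") auto
    finally show "(W\<^sup>T * W) $$ (i, j) = 1\<^sub>m n $$ (i, j)" .
  qed (auto simp: W_def)
  moreover have "col W 0 = (1 / N 0) \<cdot>\<^sub>v v"
    by (rule eq_vecI) (use n0 v hd in \<open>auto simp: W_def\<close>)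
  ultimately show thesis using that[OF W, of "1 / N 0"] N0[OF n0] by auto
qed

text \<open>An orthogonal change of basis whose first vector is an eigenvector turns the first
  column into \<open>e\<close> followed by zeros. Symmetry survives the change and clears the first
  row as well.\<close>

lemma symmetric_deflation:
  fixes A :: "real mat"
  assumes A: "A \<in> carrier_mat (Suc n) (Suc n)" and sym: "A\<^sup>T = A" and ev: "eigenvalue A e"
  obtains W B where "W \<in> carrier_mat (Suc n) (Suc n)" "W\<^sup>T * W = 1\<^sub>m (Suc n)"
    "B \<in> carrier_mat n n" "B\<^sup>T = B"
    "W\<^sup>T * A * W = four_block_mat (mat 1 1 (\<lambda>_. e)) (0\<^sub>m 1 n) (0\<^sub>m n 1) B"
proof -
  obtain v where v: "v \<in> carrier_vec (Suc n)" "v \<noteq> 0\<^sub>v (Suc n)" "A *\<^sub>v v = e \<cdot>\<^sub>v v"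
    using ev A by (auto simp: eigenvalue_def eigenvector_def)
  obtain W c where W: "W \<in> carrier_mat (Suc n) (Suc n)" "W\<^sup>T * W = 1\<^sub>m (Suc n)"
    and c: "c \<noteq> 0" "col W 0 = c \<cdot>\<^sub>v v"
    using orthonormal_basis_completion[OF v(1,2)] by blast
  define C where "C = W\<^sup>T * A * W"
  have C: "C \<in> carrier_mat (Suc n) (Suc n)" using A W by (auto simp: C_def)
  have "C\<^sup>T = W\<^sup>T * (W\<^sup>T * A)\<^sup>T"
    unfolding C_def by (rule transpose_mult[of _ "Suc n" "Suc n" _ "Suc n"]) (use A W in auto)
  also have "(W\<^sup>T * A)\<^sup>T = A * W"
    using transpose_mult[of "W\<^sup>T" "Suc n" "Suc n" A "Suc n"] A W sym by simp
  also have "W\<^sup>T * (A * W) = C"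
    unfolding C_def using A W by (simp add: assoc_mult_mat[of _ "Suc n" "Suc n" _ "Suc n" _ "Suc n"])
  finally have symC: "C\<^sup>T = C" .
  have swap: "C $$ (i, j) = C $$ (j, i)" if "i < Suc n" "j < Suc n" for i j
    using arg_cong[OF symC, of "\<lambda>M. M $$ (i, j)"] C that by simp
  have Aw: "A *\<^sub>v col W 0 = e \<cdot>\<^sub>v col W 0"
    using A v c by (simp add: mult_mat_vec smult_smult_assoc mult.commute)
  have C0: "C $$ (i, 0) = (if i = 0 then e else 0)" if i: "i < Suc n" for i
  proof -
    have "C = W\<^sup>T * (A * W)"
      unfolding C_def using A W by (simp add: assoc_mult_mat[of _ "Suc n" "Suc n" _ "Suc n" _ "Suc n"])
    hence "C $$ (i, 0) = col W i \<bullet> col (A * W) 0"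
      using A W i by simp
    also have "col (A * W) 0 = A *\<^sub>v col W 0" using A W by (intro col_mult2) auto
    also have "\<dots> = e \<cdot>\<^sub>v col W 0" by (rule Aw)
    also have "col W i \<bullet> (e \<cdot>\<^sub>v col W 0) = e * (col W i \<bullet> col W 0)"
      using W by simp
    also have "col W i \<bullet> col W 0 = (W\<^sup>T * W) $$ (i, 0)" using W(1) i by simp
    also have "\<dots> = (if i = 0 then 1 else 0)" using W(2) i by simp
    finally show ?thesis by simp
  qed
  define B where "B = mat n n (\<lambda>(i, j). C $$ (Suc i, Suc j))"
  show thesis
  proof (rule that[OF W])
    show "B \<in> carrier_mat n n" by (simp add: B_def)
    show "B\<^sup>T = B" by (rule eq_matI) (auto simp: B_def intro: swap)
    show "W\<^sup>T * A * W = four_block_mat (mat 1 1 (\<lambda>_. e)) (0\<^sub>m 1 n) (0\<^sub>m n 1) B"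
      unfolding C_def[symmetric]
    proof (rule eq_matI)
      fix i j
      assume "i < dim_row (four_block_mat (mat 1 1 (\<lambda>_. e)) (0\<^sub>m 1 n) (0\<^sub>m n 1) B)"
        "j < dim_col (four_block_mat (mat 1 1 (\<lambda>_. e)) (0\<^sub>m 1 n) (0\<^sub>m n 1) B)"
      hence ij: "i < Suc n" "j < Suc n" by (auto simp: B_def)
      show "C $$ (i, j) = four_block_mat (mat 1 1 (\<lambda>_. e)) (0\<^sub>m 1 n) (0\<^sub>m n 1) B $$ (i, j)"
        using ij C0[of i] C0[of j] swap[of i j]
        by (cases i; cases j) (auto simp: B_def)
    qed (use C in \<open>auto simp: B_def\<close>)
  qed
qed

text \<open>Induction on the dimension, splitting off the head of \<open>es\<close> by deflation.
  The factor \<open>[:-e, 1:]\<close> of the characteristic polynomial accounts for that head, so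
  the tail of \<open>es\<close> is the spectrum of the remaining block. The order of
  \<open>es\<close> is arbitrary, which later allows the sorted list of eigenvalues.\<close>

theorem real_spectral_theorem:
  fixes A :: "real mat"
  assumes "A \<in> carrier_mat n n" and "A\<^sup>T = A"
    and "mset es = proots (char_poly A)" and "length es = n"
  obtains U where "U \<in> carrier_mat n n" "U\<^sup>T * U = 1\<^sub>m n" "A = U * mat_diag n ((!) es) * U\<^sup>T"
proof -
  have "\<exists>U \<in> carrier_mat n n. U\<^sup>T * U = 1\<^sub>m n \<and> A = U * mat_diag n ((!) es) * U\<^sup>T"
    using assms
  proof (induction n arbitrary: A es)
    case 0
    thus ?case by (intro bexI[of _ "1\<^sub>m 0"]) auto
  next
    case (Suc n)
    let ?N = "Suc n"
    note A = Suc.prems(1)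
    note assoc = assoc_mult_mat[of _ ?N ?N _ ?N _ ?N]
    obtain e es' where es: "es = e # es'" using Suc.prems(4) by (cases es) auto
    have cp0: "char_poly A \<noteq> 0" using degree_monic_char_poly[OF A] by auto
    have "e \<in># proots (char_poly A)" using Suc.prems(3) by (simp add: es flip: Suc.prems(3))
    hence "eigenvalue A e" using cp0 eigenvalue_root_char_poly[OF A] by simp
    then obtain W B where W: "W \<in> carrier_mat ?N ?N" "W\<^sup>T * W = 1\<^sub>m ?N"
      and B: "B \<in> carrier_mat n n" "B\<^sup>T = B"
      and C: "W\<^sup>T * A * W = four_block_mat (mat 1 1 (\<lambda>_. e)) (0\<^sub>m 1 n) (0\<^sub>m n 1) B"
      using symmetric_deflation[OF A Suc.prems(2)] by blast
    define C' where "C' = four_block_mat (mat 1 1 (\<lambda>_. e)) (0\<^sub>m 1 n) (0\<^sub>m n 1) B"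
    have C'c: "C' \<in> carrier_mat ?N ?N" using B by (auto simp: C'_def)
    have WT: "W * W\<^sup>T = 1\<^sub>m ?N" using mat_mult_left_right_inverse[of "W\<^sup>T" ?N W] W by simp
    have AW: "A = W * C' * W\<^sup>T"
    proof -
      have "W * C' * W\<^sup>T = W * (W\<^sup>T * A * W) * W\<^sup>T" by (simp add: C C'_def)
      also have "\<dots> = (W * W\<^sup>T) * A * (W * W\<^sup>T)" using W(1) A by (simp add: assoc)
      finally show ?thesis using A by (simp add: WT)
    qed
    have "similar_mat A C'"
      by (rule similar_matI[of _ _ W "W\<^sup>T" ?N]) (use A W WT C'c AW in auto)
    hence "char_poly A = char_poly C'" by (rule char_poly_similar)
    also have "\<dots> = char_poly (mat 1 1 (\<lambda>_. e)) * char_poly B"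
      unfolding C'_def by (rule char_poly_four_block_zeros_col) (use B in auto)
    also have "char_poly (mat 1 1 (\<lambda>_. e)) = [:-e, 1:]"
      by (simp add: char_poly_defs det_def sign_def)
    finally have cp: "char_poly A = [:-e, 1:] * char_poly B" .
    have "proots (char_poly A) = proots [:-e, 1:] + proots (char_poly B)"
      using cp cp0 by (metis proots_mult mult_eq_0_iff)
    hence "mset es' = proots (char_poly B)"
      using Suc.prems(3) by (simp add: es)
    then obtain U where U: "U \<in> carrier_mat n n" "U\<^sup>T * U = 1\<^sub>m n"
      "B = U * mat_diag n ((!) es') * U\<^sup>T"
      using Suc.IH[OF B] Suc.prems(4) by (auto simp: es)
    \<comment> \<open>\<open>F\<close> extends the diagonalizing matrix of the block
      \<open>B\<close> by a fixed first coordinate; \<open>W * F\<close> will be the orthogonal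
      matrix for \<open>A\<close>.\<close>
    define F where "F = four_block_mat (1\<^sub>m 1) (0\<^sub>m 1 n) (0\<^sub>m n 1) U"
    have F: "F \<in> carrier_mat ?N ?N" using U by (auto simp: F_def)
    have FT: "F\<^sup>T = four_block_mat (1\<^sub>m 1) (0\<^sub>m 1 n) (0\<^sub>m n 1) (U\<^sup>T)"
      unfolding F_def by (subst transpose_four_block_mat[of _ 1 1 _ n _ n]) (use U in auto)
    have one: "four_block_mat (1\<^sub>m 1) (0\<^sub>m 1 n) (0\<^sub>m n 1) (1\<^sub>m n) = 1\<^sub>m ?N"
      by (rule eq_matI) auto
    have FF: "F\<^sup>T * F = 1\<^sub>m ?N"
      unfolding FT unfolding F_def
      by (subst mult_four_block_mat[of _ 1 1 _ n _ n _ _ 1 _ n]) (use U one in auto)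
    have diag: "mat_diag ?N ((!) es) =
        four_block_mat (mat 1 1 (\<lambda>_. e)) (0\<^sub>m 1 n) (0\<^sub>m n 1) (mat_diag n ((!) es'))"
      by (rule eq_matI) (auto simp: mat_diag_def es nth_Cons split: nat.splits)
    have UD: "U * mat_diag n ((!) es') \<in> carrier_mat n n"
      by (rule mult_carrier_mat[OF U(1) mat_diag_dim])
    have UDU: "U * mat_diag n ((!) es') * U\<^sup>T \<in> carrier_mat n n"
      by (rule mult_carrier_mat[OF UD]) (use U in simp)
    have "F * mat_diag ?N ((!) es) =
        four_block_mat (mat 1 1 (\<lambda>_. e)) (0\<^sub>m 1 n) (0\<^sub>m n 1) (U * mat_diag n ((!) es'))"
      unfolding F_def diag
      by (subst mult_four_block_mat[of _ 1 1 _ n _ n _ _ 1 _ n])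
        (use U in \<open>auto simp: left_mult_zero_mat[OF mat_diag_dim]\<close>)
    hence "F * mat_diag ?N ((!) es) * F\<^sup>T = C'"
      unfolding FT C'_def
      by (simp, subst mult_four_block_mat[of _ 1 1 _ n _ n _ _ 1 _ n])
        (use U UD in \<open>auto simp: right_mult_zero_mat[OF UD]
          left_add_zero_mat[OF UDU]\<close>)
    moreover define D where "D = mat_diag ?N ((!) es)"
    ultimately have "A = W * (F * D * F\<^sup>T) * W\<^sup>T" using AW by simp
    also have "\<dots> = (W * F) * D * (F\<^sup>T * W\<^sup>T)"
    proof -
      have "D \<in> carrier_mat ?N ?N" by (simp add: D_def)
      thus ?thesis using W(1) F by (simp add: assoc)
    qed
    also have "F\<^sup>T * W\<^sup>T = (W * F)\<^sup>T"
      using transpose_mult[OF W(1) F] by simp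
    finally have dec: "A = (W * F) * mat_diag ?N ((!) es) * (W * F)\<^sup>T"
      unfolding D_def .
    have "(W * F)\<^sup>T * (W * F) = F\<^sup>T * (W\<^sup>T * W) * F"
      using W(1) F transpose_mult[OF W(1) F] by (simp add: assoc)
    hence "(W * F)\<^sup>T * (W * F) = 1\<^sub>m ?N" using F W(2) FF by simp
    with dec show ?case using W(1) F by (intro bexI[of _ "W * F"]) auto
  qed
  thus thesis using that by blast
qed

section \<open>Quadratic forms and eigenvalue sums of a spectral decomposition\<close>

lemma sum_rotate:
  "(\<Sum>i\<in>I. \<Sum>j\<in>J. \<Sum>k\<in>K. f i j k) = (\<Sum>j\<in>J. \<Sum>k\<in>K. \<Sum>i\<in>I. f i j k)"
  by (subst sum.swap) (intro sum.cong refl sum.swap)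

text \<open>\<open>V i\<close> is the eigenvector for \<open>ev i\<close>, written as a function of
  the index. With the \<open>V i\<close> as rows of a matrix, \<open>orthonormal\<close> says that V
  V^T is the identity and \<open>complete\<close> that V^T V is. Indices start at 0.\<close>

locale spectral_decomposition =
  fixes n :: nat and A V :: "nat \<Rightarrow> nat \<Rightarrow> real" and ev :: "nat \<Rightarrow> real"
  assumes decomp: "j < n \<Longrightarrow> k < n \<Longrightarrow> A j k = (\<Sum>i<n. ev i * V i j * V i k)"
    and orthonormal: "i < n \<Longrightarrow> l < n \<Longrightarrow> (\<Sum>j<n. V i j * V l j) = (if i = l then 1 else 0)"
    and complete: "j < n \<Longrightarrow> k < n \<Longrightarrow> (\<Sum>i<n. V i j * V i k) = (if j = k then 1 else 0)"
    and antimono: "i \<le> l \<Longrightarrow> l < n \<Longrightarrow> ev l \<le> ev i"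
begin

definition coord :: "(nat \<Rightarrow> real) \<Rightarrow> nat \<Rightarrow> real" where
  "coord x i = (\<Sum>j<n. V i j * x j)"

lemma quadratic_form_coord:
  "(\<Sum>j<n. \<Sum>k<n. A j k * x j * x k) = (\<Sum>i<n. ev i * (coord x i)\<^sup>2)"
proof -
  have "(\<Sum>j<n. \<Sum>k<n. A j k * x j * x k) =
      (\<Sum>j<n. \<Sum>k<n. \<Sum>i<n. ev i * (V i j * x j) * (V i k * x k))"
    by (intro sum.cong refl) (simp add: decomp sum_distrib_left sum_distrib_right mult_ac)
  also have "\<dots> = (\<Sum>i<n. \<Sum>j<n. \<Sum>k<n. ev i * (V i j * x j) * (V i k * x k))"
    by (rule sum_rotate[symmetric])
  also have "\<dots> = (\<Sum>i<n. ev i * (coord x i)\<^sup>2)"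
    by (intro sum.cong refl)
      (simp add: coord_def power2_eq_square sum_product sum_distrib_left mult_ac)
  finally show ?thesis .
qed

text \<open>Parseval's identity, a consequence of \<open>complete\<close>.\<close>

lemma sum_squares_coord: "(\<Sum>j<n. (x j)\<^sup>2) = (\<Sum>i<n. (coord x i)\<^sup>2)"
proof -
  have "(\<Sum>i<n. (coord x i)\<^sup>2) = (\<Sum>i<n. \<Sum>j<n. \<Sum>k<n. V i j * V i k * (x j * x k))"
    by (simp add: coord_def power2_eq_square sum_product mult_ac)
  also have "\<dots> = (\<Sum>j<n. \<Sum>k<n. \<Sum>i<n. V i j * V i k * (x j * x k))"
    by (rule sum_rotate)
  also have "\<dots> = (\<Sum>j<n. \<Sum>k<n. if j = k then x j * x k else 0)"
    by (intro sum.cong refl) (simp add: complete flip: sum_distrib_right)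
  finally show ?thesis by (simp add: power2_eq_square)
qed

lemma trace_eq: "(\<Sum>j<n. A j j) = (\<Sum>i<n. ev i)"
proof -
  have "(\<Sum>j<n. A j j) = (\<Sum>i<n. \<Sum>j<n. ev i * (V i j * V i j))"
    by (subst sum.swap) (intro sum.cong refl, simp add: decomp mult_ac)
  also have "\<dots> = (\<Sum>i<n. ev i)"
    by (intro sum.cong refl) (simp add: orthonormal flip: sum_distrib_left)
  finally show ?thesis .
qed

text \<open>The squared Frobenius norm: one factor \<open>A j k\<close> is expanded by
  \<open>decomp\<close>, and the other acts on the eigenvectors \<open>V i\<close> by multiplication
  with \<open>ev i\<close>.\<close>

lemma sum_squares_eq: "(\<Sum>j<n. \<Sum>k<n. (A j k)\<^sup>2) = (\<Sum>i<n. (ev i)\<^sup>2)"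
proof -
  have AV: "(\<Sum>k<n. A j k * V l k) = ev l * V l j" if "j < n" "l < n" for j l
  proof -
    have "(\<Sum>k<n. A j k * V l k) = (\<Sum>k<n. \<Sum>i<n. ev i * V i j * (V i k * V l k))"
      using that by (intro sum.cong refl) (simp add: decomp sum_distrib_left sum_distrib_right mult_ac)
    also have "\<dots> = (\<Sum>i<n. ev i * V i j * (\<Sum>k<n. V i k * V l k))"
      by (subst sum.swap) (simp add: sum_distrib_left)
    also have "\<dots> = (\<Sum>i<n. if i = l then ev i * V i j else 0)"
      using that by (intro sum.cong refl) (simp add: orthonormal)
    finally show ?thesis using that by simp
  qed
  have "(\<Sum>j<n. \<Sum>k<n. (A j k)\<^sup>2) = (\<Sum>j<n. \<Sum>k<n. \<Sum>i<n. ev i * V i j * (A j k * V i k))"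
  proof (intro sum.cong refl)
    fix j k assume "j \<in> {..<n}" "k \<in> {..<n}"
    hence "A j k * A j k = A j k * (\<Sum>i<n. ev i * V i j * V i k)" using decomp[of j k] by simp
    thus "(A j k)\<^sup>2 = (\<Sum>i<n. ev i * V i j * (A j k * V i k))"
      by (simp add: power2_eq_square sum_distrib_left mult_ac)
  qed
  also have "\<dots> = (\<Sum>j<n. \<Sum>i<n. ev i * V i j * (\<Sum>k<n. A j k * V i k))"
    by (rule sum.cong[OF refl], subst sum.swap) (simp add: sum_distrib_left)
  also have "\<dots> = (\<Sum>j<n. \<Sum>i<n. (ev i)\<^sup>2 * (V i j * V i j))"
    by (intro sum.cong refl) (simp add: AV power2_eq_square mult_ac)
  also have "\<dots> = (\<Sum>i<n. (ev i)\<^sup>2 * (\<Sum>j<n. V i j * V i j))"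
    by (subst sum.swap) (simp add: sum_distrib_left)
  also have "\<dots> = (\<Sum>i<n. (ev i)\<^sup>2)" by (intro sum.cong refl) (simp add: orthonormal)
  finally show ?thesis .
qed

text \<open>The condition places \<open>x\<close> in the span of the eigenvectors with indices up to
  \<open>k\<close>, whose eigenvalues are all at least \<open>ev k\<close>.\<close>

lemma rayleigh_ge:
  assumes "k < n" and "\<And>i. k < i \<Longrightarrow> i < n \<Longrightarrow> coord x i = 0"
  shows "ev k * (\<Sum>j<n. (x j)\<^sup>2) \<le> (\<Sum>i<n. \<Sum>j<n. A i j * x i * x j)"
  unfolding quadratic_form_coord sum_squares_coord[of x] sum_distrib_left
proof (rule sum_mono)
  fix i assume i: "i \<in> {..<n}"
  show "ev k * (coord x i)\<^sup>2 \<le> ev i * (coord x i)\<^sup>2"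
  proof (cases "i \<le> k")
    case True
    thus ?thesis using antimono[OF True assms(1)] by (intro mult_right_mono) auto
  qed (use assms i in auto)
qed

text \<open>Here \<open>x\<close> is orthogonal to the first \<open>k\<close> eigenvectors, so that
  only eigenvalues at most \<open>ev k\<close> contribute.\<close>

lemma rayleigh_le:
  assumes "k < n" and "\<And>i. i < k \<Longrightarrow> coord x i = 0"
  shows "(\<Sum>i<n. \<Sum>j<n. A i j * x i * x j) \<le> ev k * (\<Sum>j<n. (x j)\<^sup>2)"
  unfolding quadratic_form_coord sum_squares_coord[of x] sum_distrib_left
proof (rule sum_mono)
  fix i assume i: "i \<in> {..<n}"
  show "ev i * (coord x i)\<^sup>2 \<le> ev k * (coord x i)\<^sup>2"
  proof (cases "k \<le> i")
    case True
    thus ?thesis using antimono[OF True] i by (intro mult_right_mono) auto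
  qed (use assms i in auto)
qed

end

section \<open>Weyl inequalities for two matrices with sum J - I\<close>

lemma nontrivial_common_zero:
  fixes f :: "nat \<Rightarrow> nat \<Rightarrow> real"
  assumes "m < n"
  obtains x where "(\<Sum>j<n. (x j)\<^sup>2) > 0" "\<And>i. i < m \<Longrightarrow> (\<Sum>j<n. f i j * x j) = 0"
proof -
  define M where "M = mat n n (\<lambda>(i, j). if i < m then f i j else 0)"
  have M: "M \<in> carrier_mat n n" by (simp add: M_def)
  \<comment> \<open>The conditions are padded with zero rows to a square matrix. Row
    \<open>m\<close> is one of these, and expanding along it gives 0.\<close>
  have "det M = 0"
    using laplace_expansion_row[OF M assms] assms by (simp add: M_def)
  then obtain v where v: "v \<in> carrier_vec n" "v \<noteq> 0\<^sub>v n" "M *\<^sub>v v = 0\<^sub>v n"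
    using det_0_iff_vec_prod_zero[OF M] by blast
  show thesis
  proof (rule that[of "\<lambda>j. v $ j"])
    obtain j where "j < n" "v $ j \<noteq> 0" using v(1,2) by (auto simp: vec_eq_iff)
    thus "(\<Sum>j<n. (v $ j)\<^sup>2) > 0" by (intro sum_pos2[of _ j]) auto
  next
    fix i assume i: "i < m"
    have "(M *\<^sub>v v) $ i = 0" using v(3) i assms by simp
    thus "(\<Sum>j<n. f i j * v $ j) = 0"
      using i assms v(1) by (simp add: M_def scalar_prod_def atLeast0LessThan)
  qed
qed

locale complementary_spectra =
  A: spectral_decomposition n A V al + B: spectral_decomposition n B U be
  for n :: nat and A B V U al be +
  assumes sum_eq: "j < n \<Longrightarrow> k < n \<Longrightarrow> A j k + B j k = (if j = k then 0 else 1)"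
begin

lemma quadratic_form_add:
  "(\<Sum>i<n. \<Sum>j<n. A i j * x i * x j) + (\<Sum>i<n. \<Sum>j<n. B i j * x i * x j) =
     (\<Sum>j<n. x j)\<^sup>2 - (\<Sum>j<n. (x j)\<^sup>2)"
proof -
  have "(\<Sum>i<n. \<Sum>j<n. A i j * x i * x j) + (\<Sum>i<n. \<Sum>j<n. B i j * x i * x j) =
      (\<Sum>i<n. \<Sum>j<n. (A i j + B i j) * (x i * x j))"
    by (simp add: distrib_right sum.distrib mult.assoc)
  also have "\<dots> = (\<Sum>i<n. \<Sum>j<n. x i * x j - (if i = j then x i * x j else 0))"
    by (intro sum.cong refl) (simp add: sum_eq)
  also have "\<dots> = (\<Sum>j<n. x j)\<^sup>2 - (\<Sum>j<n. (x j)\<^sup>2)"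
    by (simp add: sum_subtractf power2_eq_square sum_product)
  finally show ?thesis .
qed

text \<open>On a vector with coordinate sum 0 the form of J - I equals minus the squared norm. If
  the vector also lies in the span of the leading eigenvectors on both sides, the two Rayleigh lower
  bounds add up to at most that.\<close>

lemma weyl_upper:
  assumes "i < n" "j < n" "i + j = n"
  shows "al i + be j \<le> -1"
proof -
  \<comment> \<open>The \<open>n - 1 - i\<close> last eigenvectors of \<open>A\<close>, the \<open>n - 1 - j\<close> last ones of \<open>B\<close> and the
    all-ones vector are \<open>n - 1\<close> linear conditions.\<close>
  define f where "f = (\<lambda>r. if r < n - 1 - i then V (Suc i + r)
     else if r < n - 2 then U (Suc j + (r - (n - 1 - i))) else (\<lambda>_. 1))"
  have n: "n - 1 < n" using assms by simp
  obtain x where x: "(\<Sum>j<n. (x j)\<^sup>2) > 0"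
    and z: "\<And>r. r < n - 1 \<Longrightarrow> (\<Sum>j<n. f r j * x j) = 0"
    using nontrivial_common_zero[OF n, of f] by blast
  have "A.coord x k = 0" if k: "i < k" "k < n" for k
  proof -
    have "k - Suc i < n - 1 - i" "Suc i + (k - Suc i) = k" "k - Suc i < n - 1" using k by auto
    thus ?thesis using z[of "k - Suc i"] by (simp only: f_def A.coord_def if_True)
  qed
  hence 1: "al i * (\<Sum>j<n. (x j)\<^sup>2) \<le> (\<Sum>i<n. \<Sum>j<n. A i j * x i * x j)"
    using assms by (intro A.rayleigh_ge) auto
  have "B.coord x k = 0" if k: "j < k" "k < n" for k
  proof -
    have "\<not> k - Suc j + (n - 1 - i) < n - 1 - i" "k - Suc j + (n - 1 - i) < n - 2"
      "k - Suc j + (n - 1 - i) < n - 1"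
      "Suc j + (k - Suc j + (n - 1 - i) - (n - 1 - i)) = k" using k assms by auto
    thus ?thesis
      using z[of "k - Suc j + (n - 1 - i)"] by (simp only: f_def B.coord_def if_True if_False)
  qed
  hence 2: "be j * (\<Sum>j<n. (x j)\<^sup>2) \<le> (\<Sum>i<n. \<Sum>j<n. B i j * x i * x j)"
    using assms by (intro B.rayleigh_ge) auto
  have 3: "(\<Sum>j<n. x j) = 0"
  proof -
    have "\<not> n - 2 < n - 1 - i" "\<not> n - 2 < n - 2" "n - 2 < n - 1" using assms by auto
    thus ?thesis using z[of "n - 2"] by (simp only: f_def if_False mult_1_left)
  qed
  have "(al i + be j) * (\<Sum>j<n. (x j)\<^sup>2) \<le> -1 * (\<Sum>j<n. (x j)\<^sup>2)"
    using 1 2 quadratic_form_add[of x] unfolding 3 by (simp only: distrib_right) simp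
  thus ?thesis using x by (metis mult_le_cancel_right_pos)
qed

text \<open>Some nonzero \<open>x\<close> is orthogonal to the first \<open>i\<close> eigenvectors
  of \<open>A\<close> and the first \<open>j\<close> of \<open>B\<close>, since these are fewer than
  \<open>n\<close> conditions. Both forms are then bounded above, while the form of J is
  nonnegative.\<close>

lemma weyl_lower:
  assumes "i + j < n"
  shows "-1 \<le> al i + be j"
proof -
  define f where "f = (\<lambda>r. if r < i then V r else U (r - i))"
  obtain x where x: "(\<Sum>j<n. (x j)\<^sup>2) > 0"
    and z: "\<And>r. r < i + j \<Longrightarrow> (\<Sum>j<n. f r j * x j) = 0"
    using nontrivial_common_zero[OF assms, of f] by blast
  have "A.coord x k = 0" if "k < i" for k
    using z[of k] that by (simp add: f_def A.coord_def)
  hence 1: "al i * (\<Sum>j<n. (x j)\<^sup>2) \<ge> (\<Sum>i<n. \<Sum>j<n. A i j * x i * x j)"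
    using assms by (intro A.rayleigh_le) auto
  have "B.coord x k = 0" if "k < j" for k
    using z[of "i + k"] that by (simp add: f_def B.coord_def)
  hence 2: "be j * (\<Sum>j<n. (x j)\<^sup>2) \<ge> (\<Sum>i<n. \<Sum>j<n. B i j * x i * x j)"
    using assms by (intro B.rayleigh_le) auto
  have "-1 * (\<Sum>j<n. (x j)\<^sup>2) \<le> (al i + be j) * (\<Sum>j<n. (x j)\<^sup>2)"
    using 1 2 quadratic_form_add[of x] zero_le_power2[of "\<Sum>j<n. x j"]
    by (simp only: distrib_right)
  thus ?thesis using x by (metis mult_le_cancel_right_pos)
qed

text \<open>The all-ones vector serves as the test vector.\<close>

lemma largest_add_ge:
  assumes "n > 0"
  shows "real n - 1 \<le> al 0 + be 0"
proof -
  have 1: "al 0 * n \<ge> (\<Sum>i<n. \<Sum>j<n. A i j)" and 2: "be 0 * n \<ge> (\<Sum>i<n. \<Sum>j<n. B i j)"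
    using A.rayleigh_le[of 0 "\<lambda>_. 1"] B.rayleigh_le[of 0 "\<lambda>_. 1"] assms by auto
  have "(\<Sum>i<n. \<Sum>j<n. A i j) + (\<Sum>i<n. \<Sum>j<n. B i j) = (real n)\<^sup>2 - real n"
    using quadratic_form_add[of "\<lambda>_. 1"] by simp
  hence "(al 0 + be 0) * real n \<ge> (real n - 1) * real n"
    using 1 2 by (simp add: algebra_simps power2_eq_square)
  thus ?thesis using assms by (simp add: mult_le_cancel_right)
qed

end

section \<open>Lower bounds for sums of squares\<close>

text \<open>The square lies above its tangent at \<open>t\<close>; summing this tangent inequality
  avoids dividing by \<open>card I\<close>.\<close>

lemma sum_squares_ge:
  fixes f :: "'b \<Rightarrow> real" and t :: real
  assumes "0 \<le> t" and "card I * t \<le> (\<Sum>i\<in>I. f i)"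
  shows "card I * t\<^sup>2 \<le> (\<Sum>i\<in>I. (f i)\<^sup>2)"
proof -
  have "(\<Sum>i\<in>I. 2 * t * f i - t\<^sup>2) \<le> (\<Sum>i\<in>I. (f i)\<^sup>2)"
  proof (rule sum_mono)
    fix i
    show "2 * t * f i - t\<^sup>2 \<le> (f i)\<^sup>2"
      using zero_le_power2[of "f i - t"] by (simp add: power2_diff mult_ac)
  qed
  moreover have "2 * t * (card I * t) \<le> 2 * t * (\<Sum>i\<in>I. f i)"
    using assms by (intro mult_left_mono) auto
  moreover have "(\<Sum>i\<in>I. 2 * t * f i - t\<^sup>2) = 2 * t * (\<Sum>i\<in>I. f i) - card I * t\<^sup>2"
    by (simp add: sum_subtractf sum_distrib_left)
  ultimately show ?thesis
    by (simp add: power2_eq_square algebra_simps)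
qed

lemma sum_squares_ge_neg:
  fixes f :: "'b \<Rightarrow> real" and t :: real
  assumes "0 \<le> t" and "(\<Sum>i\<in>I. f i) \<le> - (card I * t)"
  shows "card I * t\<^sup>2 \<le> (\<Sum>i\<in>I. (f i)\<^sup>2)"
  using sum_squares_ge[of t I "\<lambda>i. - f i"] assms by (simp add: sum_negf)

lemma sum_split3:
  fixes f :: "nat \<Rightarrow> real"
  assumes "p \<le> q" "q \<le> n"
  shows "(\<Sum>i<n. f i) = (\<Sum>i<p. f i) + (\<Sum>i = p..<q. f i) + (\<Sum>i = q..<n. f i)"
  using assms by (simp add: sum.atLeastLessThan_concat flip: atLeast0LessThan)

text \<open>At least \<open>2 * m\<close> entries lie at or below \<open>- c\<close>. As the total
  is 0, the first \<open>m\<close> entries have sum at least \<open>2 * m * c\<close>, and their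
  squares alone suffice.\<close>

lemma sum_squares_centred_ge:
  fixes f :: "nat \<Rightarrow> real"
  assumes "0 \<le> c" and "\<And>i. m \<le> i \<Longrightarrow> i < n \<Longrightarrow> f i \<le> - c"
    and "(\<Sum>i<n. f i) = 0" and n: "3 * m + 1 \<le> n"
  shows "4 * real m * c\<^sup>2 \<le> (\<Sum>i<n. (f i)\<^sup>2)"
proof -
  have mn: "m \<le> n" using n by simp
  have "(\<Sum>i = m..<n. f i) \<le> (\<Sum>i = m..<n. - c)"
    by (rule sum_mono) (use assms in auto)
  also have "\<dots> = - (real (n - m) * c)" by simp
  also have "\<dots> \<le> - (2 * real m * c)"
    using n assms(1) by (simp add: mult_right_mono of_nat_diff)
  finally have "2 * real m * c \<le> (\<Sum>i<m. f i)"
    using assms(3) sum_split3[OF _ mn, of m f] by simp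
  hence "card {..<m} * (2 * c)\<^sup>2 \<le> (\<Sum>i<m. (f i)\<^sup>2)"
    using assms(1) by (intro sum_squares_ge) auto
  also have "\<dots> \<le> (\<Sum>i<n. (f i)\<^sup>2)" using mn by (intro sum_mono2) auto
  finally show ?thesis by (simp add: power_mult_distrib)
qed

lemma half_square_le:
  fixes x y t :: real
  assumes "0 \<le> t" "t \<le> x + y"
  shows "t\<^sup>2 / 2 \<le> x\<^sup>2 + y\<^sup>2"
proof -
  have "t\<^sup>2 \<le> (x + y)\<^sup>2" using assms by (intro power_mono) auto
  thus ?thesis using zero_le_power2[of "x - y"] by (simp add: power2_sum power2_diff)
qed

text \<open>Index 0 is kept apart because the largest eigenvalue has its own, much stronger
  bound.\<close>

lemma sum_squares_ge_head:
  fixes f :: "nat \<Rightarrow> real"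
  assumes "m < n" "0 \<le> f m" and "\<And>i j. i \<le> j \<Longrightarrow> j < n \<Longrightarrow> f j \<le> f i"
  shows "(f 0)\<^sup>2 + m * (f m)\<^sup>2 \<le> (\<Sum>i<m+1. (f i)\<^sup>2)"
proof -
  have "(\<Sum>i = 1..<m+1. (f m)\<^sup>2) \<le> (\<Sum>i = 1..<m+1. (f i)\<^sup>2)"
    by (rule sum_mono) (use assms in \<open>auto intro!: power_mono\<close>)
  thus ?thesis using sum_split3[of 1 "m + 1" "m + 1" "\<lambda>i. (f i)\<^sup>2"] by simp
qed

lemma sum_squares_ge_tail:
  fixes f :: "nat \<Rightarrow> real"
  assumes "m \<le> n" "0 \<le> c" "f (n - m) \<le> - c"
    and "\<And>i j. i \<le> j \<Longrightarrow> j < n \<Longrightarrow> f j \<le> f i"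
  shows "m * c\<^sup>2 \<le> (\<Sum>i = n-m..<n. (f i)\<^sup>2)"
proof -
  have "(\<Sum>i = n-m..<n. f i) \<le> (\<Sum>i = n-m..<n. - c)"
    by (rule sum_mono) (use assms in \<open>auto intro: order_trans\<close>)
  thus ?thesis using sum_squares_ge_neg[of c f "{n-m..<n}"] assms(1,2) by simp
qed

text \<open>Since \<open>2 * m + 1 <= n\<close>, the index 0, the indices 1 to \<open>m\<close> and
  the last \<open>m\<close> indices do not overlap.\<close>

lemma sum_squares_ge_head_tail:
  fixes f :: "nat \<Rightarrow> real"
  assumes "2 * m + 1 \<le> n" "0 \<le> f m" "0 \<le> c" "f (n - m) \<le> - c"
    and "\<And>i j. i \<le> j \<Longrightarrow> j < n \<Longrightarrow> f j \<le> f i"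
  shows "(f 0)\<^sup>2 + m * (f m)\<^sup>2 + m * c\<^sup>2 \<le> (\<Sum>i<n. (f i)\<^sup>2)"
proof -
  have "0 \<le> (\<Sum>i = m+1..<n-m. (f i)\<^sup>2)" by (intro sum_nonneg) auto
  thus ?thesis
    using sum_split3[of "m + 1" "n - m" n "\<lambda>i. (f i)\<^sup>2"] assms(1)
      sum_squares_ge_head[of m n f] sum_squares_ge_tail[of m n c f] assms(2-) by auto
qed

section \<open>Sign cases for the two eigenvalues\<close>

text \<open>Stated for bare sequences, so that it can be applied a second time with the two spectra
  exchanged.\<close>

lemma mixed_sign_bound:
  fixes al be :: "nat \<Rightarrow> real" and m n :: nat
  defines "a \<equiv> al m" and "b \<equiv> be m"
  assumes m: "0 < m" and n: "3 * m + 1 \<le> n"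
    and mono_al: "\<And>i j. i \<le> j \<Longrightarrow> j < n \<Longrightarrow> al j \<le> al i"
    and mono_be: "\<And>i j. i \<le> j \<Longrightarrow> j < n \<Longrightarrow> be j \<le> be i"
    and tr_al: "(\<Sum>i<n. al i) = 0" and tr_be: "(\<Sum>i<n. be i) = 0"
    and sq: "(\<Sum>i<n. (al i)\<^sup>2) + (\<Sum>i<n. (be i)\<^sup>2) = real n * (real n - 1)"
    and up: "a + be (n - m) \<le> -1" and low: "-1 \<le> al (n - 1 - m) + b"
    and top: "real n - 1 \<le> al 0 + be 0"
    and a: "0 \<le> a" and b: "b < 0"
  shows "4 * real m * (a\<^sup>2 + b\<^sup>2) < (real n)\<^sup>2"
proof -
  define c where "c = - b"
  have c: "0 < c" "b\<^sup>2 = c\<^sup>2" using b by (auto simp: c_def)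
  have n1: "real n \<ge> 1" using n by simp
  have be_bot: "be i \<le> - (1 + a)" if "n - m \<le> i" "i < n" for i
    using mono_be[OF that] up by simp
  have be_mid: "be i \<le> - c" if "m \<le> i" "i < n" for i
    using mono_be[OF that] by (simp add: c_def b_def)
  have al_top: "a \<le> al i" if "i \<le> m" for i
    using mono_al[OF that] n by (simp add: a_def)
  have sq_bot: "m * (1 + a)\<^sup>2 \<le> (\<Sum>i = n-m..<n. (be i)\<^sup>2)"
    using n a up mono_be by (intro sum_squares_ge_tail) auto
  \<comment> \<open>Because \<open>n >= 3 * m + 1\<close>, the middle block has more than
    \<open>m\<close> entries, all at most \<open>- c\<close>.\<close>
  have sq_mid: "m * c\<^sup>2 \<le> (\<Sum>i = m..<n-m. (be i)\<^sup>2)"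
  proof -
    have "(\<Sum>i = m..<n-m. be i) \<le> (\<Sum>i = m..<n-m. - c)"
      by (rule sum_mono) (use be_mid in auto)
    hence "real (n - m - m) * c\<^sup>2 \<le> (\<Sum>i = m..<n-m. (be i)\<^sup>2)"
      using sum_squares_ge_neg[of c be "{m..<n-m}"] c by simp
    moreover have "real m * c\<^sup>2 \<le> real (n - m - m) * c\<^sup>2"
      using n by (intro mult_right_mono) auto
    ultimately show ?thesis by linarith
  qed
  note be_split = sum_split3[of m "n - m" n "\<lambda>i. (be i)\<^sup>2"]
  \<comment> \<open>For \<open>c > 1\<close> the lower Weyl bound makes \<open>al i\<close> nonnegative for all \<open>i < n - m\<close>, so that the
    trace of \<open>al\<close> is balanced by its last \<open>m\<close> terms alone; for \<open>c \<le> 1\<close> the largest eigenvalues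
    are needed as in the nonnegative case.\<close>
  show ?thesis
  proof (cases "c \<le> 1")
    case True
    have "(al 0)\<^sup>2 + m * a\<^sup>2 \<le> (\<Sum>i<m+1. (al i)\<^sup>2)"
      unfolding a_def using n a mono_al by (intro sum_squares_ge_head) (auto simp: a_def)
    moreover have "(\<Sum>i<m+1. (al i)\<^sup>2) \<le> (\<Sum>i<n. (al i)\<^sup>2)"
      using n by (intro sum_mono2) auto
    moreover have "(be 0)\<^sup>2 \<le> (\<Sum>i<m. (be i)\<^sup>2)"
      using m by (intro member_le_sum) auto
    moreover have "(real n - 1)\<^sup>2 / 2 \<le> (al 0)\<^sup>2 + (be 0)\<^sup>2"
      using top n1 by (intro half_square_le) auto
    ultimately have "(real n - 1)\<^sup>2 / 2 + m * a\<^sup>2 + m * (1 + a)\<^sup>2 + m * c\<^sup>2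
        \<le> real n * (real n - 1)"
      using sq sq_bot sq_mid be_split n by simp
    \<comment> \<open>The summand \<open>m\<close> in the expansion of \<open>m * (1 + a)^2\<close>
      pays for the second copy of \<open>m * c^2\<close>. Doubling the whole estimate then yields
      the upper bound \<open>n^2 - 1\<close>.\<close>
    moreover have "real m * c\<^sup>2 \<le> real m * 1"
      using True c by (intro mult_left_mono) (auto simp: power_le_one)
    moreover have "0 \<le> real m * a" using a by simp
    moreover have "real m * (1 + a)\<^sup>2 = real m + 2 * (real m * a) + real m * a\<^sup>2"
      "(real n - 1)\<^sup>2 = (real n)\<^sup>2 - 2 * real n + 1"
      "real n * (real n - 1) = (real n)\<^sup>2 - real n"
      "4 * real m * (a\<^sup>2 + c\<^sup>2) = 4 * (real m * a\<^sup>2) + 4 * (real m * c\<^sup>2)"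
      by (simp_all add: power2_eq_square algebra_simps)
    ultimately show ?thesis unfolding c(2) by linarith
  next
    case False
    have al_nonneg: "0 \<le> al i" if "i < n - m" for i
    proof -
      have "al (n - 1 - m) \<le> al i" using that by (intro mono_al) auto
      thus ?thesis using low False by (simp add: c_def)
    qed
    have ac: "c - 1 \<le> a"
    proof -
      have "al (n - 1 - m) \<le> a" unfolding a_def using n by (intro mono_al) auto
      thus ?thesis using low by (simp add: c_def)
    qed
    have al_sum: "m * a \<le> (\<Sum>i<m. al i)"
      using sum_mono[of "{..<m}" "\<lambda>_. a" al] al_top by simp
    have al_pos: "m * a \<le> (\<Sum>i<n-m. al i)"
    proof -
      have "(\<Sum>i<m. al i) \<le> (\<Sum>i<n-m. al i)"
        using n al_nonneg by (intro sum_mono2) auto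
      thus ?thesis using al_sum by simp
    qed
    have "m * a\<^sup>2 \<le> (\<Sum>i<n-m. (al i)\<^sup>2)"
    proof -
      have "m * a\<^sup>2 \<le> (\<Sum>i<m. (al i)\<^sup>2)"
        using sum_squares_ge[of a "{..<m}" al] a al_sum by simp
      also have "\<dots> \<le> (\<Sum>i<n-m. (al i)\<^sup>2)" using n by (intro sum_mono2) auto
      finally show ?thesis .
    qed
    moreover have "m * a\<^sup>2 \<le> (\<Sum>i = n-m..<n. (al i)\<^sup>2)"
      using sum_squares_ge_neg[of a al "{n-m..<n}"] a al_pos n tr_al sum_split3[of "n-m" "n-m" n al]
      by simp
    ultimately have al_sq: "2 * m * a\<^sup>2 \<le> (\<Sum>i<n. (al i)\<^sup>2)"
      using sum_split3[of "n-m" "n-m" n "\<lambda>i. (al i)\<^sup>2"] by simp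
    \<comment> \<open>The trace is 0, so the first \<open>m\<close> entries must balance the middle
      block, with sum at most \<open>- m * c\<close>, and the last block, with sum at most
      \<open>- m * (1 + a)\<close>.\<close>
    have be_sq: "m * (c + 1 + a)\<^sup>2 \<le> (\<Sum>i<m. (be i)\<^sup>2)"
    proof -
      have "(\<Sum>i = m..<n-m. be i) \<le> (\<Sum>i = m..<n-m. - c)"
        by (rule sum_mono) (use be_mid in auto)
      also have "\<dots> = - (real (n - m - m) * c)" by simp
      also have "\<dots> \<le> - (real m * c)" using n c by (simp add: mult_right_mono)
      finally have mid: "(\<Sum>i = m..<n-m. be i) \<le> - (real m * c)" .
      have "(\<Sum>i = n-m..<n. be i) \<le> (\<Sum>i = n-m..<n. - (1 + a))"
        by (rule sum_mono) (use be_bot in auto)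
      also have "\<dots> = - (real m * (1 + a))" using n by (simp add: algebra_simps)
      finally have "m * (c + 1 + a) \<le> (\<Sum>i<m. be i)"
        using mid tr_be sum_split3[of m "n - m" n be] n by (simp add: algebra_simps)
      thus ?thesis using sum_squares_ge[of "c + 1 + a" "{..<m}" be] a c by simp
    qed
    have "real m * (2 * a\<^sup>2 + (c + 1 + a)\<^sup>2 + c\<^sup>2 + (1 + a)\<^sup>2) \<le> real n * (real n - 1)"
      using al_sq be_sq sq sq_bot sq_mid be_split n
      by (simp add: algebra_simps)
    moreover have "real m * (4 * (a\<^sup>2 + c\<^sup>2)) \<le>
        real m * (2 * a\<^sup>2 + (c + 1 + a)\<^sup>2 + c\<^sup>2 + (1 + a)\<^sup>2)"
    proof (rule mult_left_mono)
      \<comment> \<open>The right side of the goal exceeds the left by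
        \<open>2 * ((1 + a)^2 - a^2) + 2 * (c * (1 + a) - c^2)\<close>, and both summands are
        nonnegative.\<close>
      have "c * c \<le> c * (a + 1)" using c ac by (intro mult_left_mono) auto
      thus "4 * (a\<^sup>2 + c\<^sup>2) \<le> 2 * a\<^sup>2 + (c + 1 + a)\<^sup>2 + c\<^sup>2 + (1 + a)\<^sup>2"
        using a by (simp add: power2_eq_square algebra_simps)
    qed simp
    moreover have "real n * (real n - 1) < (real n)\<^sup>2"
      using n1 by (simp add: power2_eq_square algebra_simps)
    moreover have "4 * real m * (a\<^sup>2 + c\<^sup>2) = real m * (4 * (a\<^sup>2 + c\<^sup>2))" by simp
    ultimately show ?thesis unfolding c(2) by linarith
  qed
qed

lemma (in complementary_spectra) eigenvalue_sum_squares_less: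
  fixes m :: nat
  assumes m: "0 < m" and n: "3 * m + 1 \<le> n"
    and tr_al: "(\<Sum>i<n. al i) = 0" and tr_be: "(\<Sum>i<n. be i) = 0"
    and sq: "(\<Sum>i<n. (al i)\<^sup>2) + (\<Sum>i<n. (be i)\<^sup>2) = real n * (real n - 1)"
  shows "4 * real m * ((al m)\<^sup>2 + (be m)\<^sup>2) < (real n)\<^sup>2"
proof -
  have top: "real n - 1 \<le> al 0 + be 0" using n by (intro largest_add_ge) auto
  \<comment> \<open>Positivity of \<open>m\<close> keeps the index \<open>n - m\<close> below
    \<open>n\<close>.\<close>
  have up: "al m + be (n - m) \<le> -1" "al (n - m) + be m \<le> -1"
    using m n by (auto intro!: weyl_upper)
  have low: "-1 \<le> al (n - 1 - m) + be m" "-1 \<le> al m + be (n - 1 - m)"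
    using n by (auto intro!: weyl_lower)
  have n1: "real n * (real n - 1) < (real n)\<^sup>2"
    using n by (simp add: power2_eq_square algebra_simps)
  consider "0 \<le> al m" "0 \<le> be m" | "0 \<le> al m" "be m < 0" | "al m < 0" "0 \<le> be m"
    | "al m < 0" "be m < 0"
    by linarith
  thus ?thesis
  proof cases
    case 1
    have top': "(real n - 1)\<^sup>2 / 2 \<le> (al 0)\<^sup>2 + (be 0)\<^sup>2"
      using top n by (intro half_square_le) auto
    have "(al 0)\<^sup>2 + m * (al m)\<^sup>2 + m * (1 + be m)\<^sup>2 \<le> (\<Sum>i<n. (al i)\<^sup>2)"
      using 1 up(2) n A.antimono by (intro sum_squares_ge_head_tail) auto
    moreover have "(be 0)\<^sup>2 + m * (be m)\<^sup>2 + m * (1 + al m)\<^sup>2 \<le> (\<Sum>i<n. (be i)\<^sup>2)"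
      using 1 up(1) n B.antimono by (intro sum_squares_ge_head_tail) auto
    \<comment> \<open>After removing \<open>(n - 1)^2 / 2\<close>, only \<open>(n^2 - 1) / 2\<close>
      is left of \<open>n * (n - 1)\<close>; this gives the strict inequality.\<close>
    ultimately have "(real n - 1)\<^sup>2 / 2 + m * (al m)\<^sup>2 + m * (1 + be m)\<^sup>2
        + m * (be m)\<^sup>2 + m * (1 + al m)\<^sup>2 \<le> real n * (real n - 1)"
      using sq top' by simp
    moreover have "0 \<le> real m * al m" "0 \<le> real m * be m" using 1 by auto
    moreover have "real m * (1 + x)\<^sup>2 = real m + 2 * (real m * x) + real m * x\<^sup>2"
      "real m * (x\<^sup>2 + y\<^sup>2) = real m * x\<^sup>2 + real m * y\<^sup>2" for x y :: real
      by (simp_all add: power2_eq_square algebra_simps)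
    moreover have "(real n - 1)\<^sup>2 / 2 = (real n)\<^sup>2 / 2 - real n + 1 / 2"
      "real n * (real n - 1) = (real n)\<^sup>2 - real n"
      by (simp_all add: power2_eq_square field_simps)
    ultimately show ?thesis by (simp add: mult.assoc)
  next
    case 2
    show ?thesis
      by (rule mixed_sign_bound) (use assms 2 up low top A.antimono B.antimono in auto)
  next
    case 3
    have "4 * real m * ((be m)\<^sup>2 + (al m)\<^sup>2) < (real n)\<^sup>2"
      by (rule mixed_sign_bound)
        (use assms 3 up low top A.antimono B.antimono in \<open>auto simp: add.commute\<close>)
    thus ?thesis by (simp add: add.commute)
  next
    case 4
    \<comment> \<open>Both eigenvalues are negative, and each spectrum satisfies its own bound from
      its trace, without Weyl's inequalities.\<close>
    have "4 * real m * (- al m)\<^sup>2 \<le> (\<Sum>i<n. (al i)\<^sup>2)"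
      using m n 4 tr_al A.antimono by (intro sum_squares_centred_ge) auto
    moreover have "4 * real m * (- be m)\<^sup>2 \<le> (\<Sum>i<n. (be i)\<^sup>2)"
      using m n 4 tr_be B.antimono by (intro sum_squares_centred_ge) auto
    ultimately show ?thesis using sq n1 by (simp add: algebra_simps)
  qed
qed

section \<open>From graphs to their spectra\<close>

lemma adjacency_spectral_decomposition:
  assumes G: "pair_graph G" and vs: "distinct vs" "set vs = pverts G"
  obtains V where "spectral_decomposition (card (pverts G))
    (\<lambda>j k. if (vs ! j, vs ! k) \<in> parcs G then 1 else 0) V ((!) (graph_eigenvalues G))"
proof -
  interpret pair_graph G by fact
  define n where "n = card (pverts G)"
  define A where "A = adjacency_matrix G vs"
  define es where "es = graph_eigenvalues G"
  have len: "length vs = n" using vs distinct_card n_def by metis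
  have A: "A \<in> carrier_mat n n" using adjacency_matrix_carrier[of G vs] by (simp add: A_def len)
  have entry: "A $$ (j, k) = (if (vs ! j, vs ! k) \<in> parcs G then 1 else 0)"
    if "j < n" "k < n" for j k
    using that by (simp add: A_def adjacency_matrix_def len)
  have "(v, u) \<in> parcs G \<longleftrightarrow> (u, v) \<in> parcs G" for u v
    using pair_sym_arcs by (auto simp: symmetric_def sym_def)
  hence sym: "A\<^sup>T = A" by (intro eq_matI) (auto simp: A_def adjacency_matrix_def)
  have "mset es = proots (char_poly A)"
    by (simp add: es_def A_def graph_eigenvalues_eq[OF vs])
  moreover have len_es: "length es = n"
    using length_graph_eigenvalues[OF G] by (simp add: es_def n_def)
  ultimately obtain U where U: "U \<in> carrier_mat n n" "U\<^sup>T * U = 1\<^sub>m n"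
    and dec: "A = U * mat_diag n ((!) es) * U\<^sup>T"
    using real_spectral_theorem[OF A sym] by blast
  have UU: "U * U\<^sup>T = 1\<^sub>m n" using mat_mult_left_right_inverse[of "U\<^sup>T" n U] U by simp
  \<comment> \<open>The eigenvectors are the columns of \<open>U\<close>, hence the exchanged
    indices.\<close>
  have "spectral_decomposition n (\<lambda>j k. if (vs ! j, vs ! k) \<in> parcs G then 1 else 0)
    (\<lambda>i j. U $$ (j, i)) ((!) es)"
  proof
    fix j k assume jk: "j < n" "k < n"
    have "A $$ (j, k) = (U * mat_diag n ((!) es) * U\<^sup>T) $$ (j, k)" using dec by simp
    also have "\<dots> = (\<Sum>i<n. es ! i * U $$ (j, i) * U $$ (k, i))"
      unfolding mat_diag_mult_right[OF U(1)]
      using U(1) jk by (simp add: scalar_prod_def atLeast0LessThan mult_ac)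
    finally show "(if (vs ! j, vs ! k) \<in> parcs G then 1 else 0) =
        (\<Sum>i<n. es ! i * U $$ (j, i) * U $$ (k, i))"
      by (simp only: entry[OF jk])
    show "(\<Sum>i<n. U $$ (j, i) * U $$ (k, i)) = (if j = k then 1 else 0)"
      using arg_cong[OF UU, of "\<lambda>M. M $$ (j, k)"] U(1) jk
      by (simp add: scalar_prod_def atLeast0LessThan)
    show "(\<Sum>i<n. U $$ (i, j) * U $$ (i, k)) = (if j = k then 1 else 0)"
      using arg_cong[OF U(2), of "\<lambda>M. M $$ (j, k)"] U(1) jk
      by (simp add: scalar_prod_def atLeast0LessThan)
  next
    fix i l assume "i \<le> l" "l < n"
    moreover have "sorted (rev es)" by (simp add: es_def graph_eigenvalues_eq[OF vs])
    ultimately show "es ! l \<le> es ! i" using len_es by (intro sorted_rev_nth_mono) auto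
  qed
  thus thesis using that by (simp add: n_def es_def)
qed

theorem theorem3:
  fixes G :: "'a pair_pre_digraph" and s n :: nat
  assumes "s \<ge> 2" and "n \<ge> 3 * s - 2"
    and "pair_graph G" and "card (pverts G) = n"
  shows "(graph_eigenvalue s G)\<^sup>2 + (graph_eigenvalue s (graph_complement G))\<^sup>2
           < (real n)\<^sup>2 / (4 * (real s - 1))"
proof -
  interpret G: pair_graph G by fact
  define H where "H = graph_complement G"
  have H: "pair_graph H" unfolding H_def using assms(3) by (rule pair_graph_complement)
  obtain vs where vs: "distinct vs" "set vs = pverts G"
    using finite_distinct_list[OF G.pair_finite_verts] by blast
  have len: "length vs = n" using vs distinct_card assms(4) by metis
  have vH: "pverts H = pverts G" by (simp add: H_def graph_complement_def)
  define A B :: "nat \<Rightarrow> nat \<Rightarrow> real"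
    where "A = (\<lambda>j k. if (vs ! j, vs ! k) \<in> parcs G then 1 else 0)"
      and "B = (\<lambda>j k. if (vs ! j, vs ! k) \<in> parcs H then 1 else 0)"
  obtain V where V: "spectral_decomposition n A V ((!) (graph_eigenvalues G))"
    using adjacency_spectral_decomposition[OF assms(3) vs] assms(4) unfolding A_def by blast
  obtain U where U: "spectral_decomposition n B U ((!) (graph_eigenvalues H))"
    using adjacency_spectral_decomposition[OF H vs(1)] vs(2) assms(4) unfolding B_def vH by blast
  have sum: "A j k + B j k = (if j = k then 0 else 1)" if "j < n" "k < n" for j k
  proof -
    have "vs ! j \<in> pverts G" "vs ! k \<in> pverts G" "vs ! j = vs ! k \<longleftrightarrow> j = k"
      using that len vs nth_eq_iff_index_eq[OF vs(1)] by auto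
    thus ?thesis using G.pair_no_loops[of "(vs ! k, vs ! k)"]
      by (auto simp: A_def B_def H_def graph_complement_def)
  qed
  interpret complementary_spectra n A B V U
    "(!) (graph_eigenvalues G)" "(!) (graph_eigenvalues H)"
    by (intro complementary_spectra.intro complementary_spectra_axioms.intro V U sum)
  \<comment> \<open>Two entries from {0, 1} that add up to 0 both vanish.\<close>
  have diag: "A j j = 0" "B j j = 0" if "j < n" for j
    using sum[OF that that] by (auto simp: A_def B_def split: if_splits)
  have sq: "(A j k)\<^sup>2 = A j k" "(B j k)\<^sup>2 = B j k" for j k by (auto simp: A_def B_def)
  \<comment> \<open>Entries 0 and 1 equal their squares, so the sum of squares is the sum of all
    entries of J - I, its quadratic form at the all-ones vector.\<close>
  have "(\<Sum>i<n. (graph_eigenvalues G ! i)\<^sup>2) + (\<Sum>i<n. (graph_eigenvalues H ! i)\<^sup>2) =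
      real n * (real n - 1)"
    using quadratic_form_add[of "\<lambda>_. 1"]
    unfolding A.sum_squares_eq[symmetric] B.sum_squares_eq[symmetric] sq
    by (simp add: power2_eq_square algebra_simps)
  \<comment> \<open>Eigenvalues are counted from 1 and list positions from 0, so
    \<open>m = s - 1\<close>, and \<open>n >= 3 * s - 2\<close> becomes
    \<open>n >= 3 * m + 1\<close>.\<close>
  hence "4 * real (s - 1) * ((graph_eigenvalues G ! (s - 1))\<^sup>2 + (graph_eigenvalues H ! (s - 1))\<^sup>2)
      < (real n)\<^sup>2"
    using assms(1,2) A.trace_eq B.trace_eq diag
    by (intro eigenvalue_sum_squares_less) auto
  thus ?thesis
    using assms(1) by (simp add: graph_eigenvalue_def H_def of_nat_diff field_simps)
qed

end
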